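(* Let $\Sigma=(\Sigma_c,\Sigma_r)$ be a structured alphabet, let $\Sigma_\bot=(\Sigma_c\cup\{\bot_c\},\Sigma_r\cup\{\bot_r\})$ where $\bot_c,\bot_r$ are two fresh symbols, and let $\Delta$ be a finite alphabet. Visibly pushdown transducers from $\Sigma_\bot$ to $\Delta$ run on first-child next-sibling encodings are exactly as expressive as hedge-to-string transducers from $\Sigma_c\times\Sigma_r$ to $\Delta$. That is: (1) for every visibly pushdown transducer $A$ from $\Sigma_\bot$ to $\Delta$ that does not accept $\mathrm{fcns}(\epsilon)=\bot_c\bot_r$, there exists a hedge-to-string transducer $T$ from $\Sigma_c\times\Sigma_r$ to $\Delta$ that does not accept the empty hedge, such that $A\circ\mathrm{fcns}=T\circ\mathrm{hedge}$ (as relations between $\mathcal W_\Sigma$ and $\Delta^*$); and (2) for every hedge-to-string transducer $T$ from $\Sigma_c\times\Sigma_r$ to $\Delta$ that does not accept the empty hedge, there exists a visibly pushdown transducer $A$ from $\Sigma_\bot$ to $\Delta$ that does not accept $\bot_c\bot_r$, such that $A\circ\mathrm{fcns}=T\circ\mathrm{hedge}$.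
   Context: **Well-nested words.** A structured alphabet is a pair $\Sigma=(\Sigma_c,\Sigma_r)$ of disjoint finite alphabets (call and return symbols), identified with $\Sigma_c\cup\Sigma_r$. The set $\mathcal W_\Sigma$ of well-nested words is the least set of words over $\Sigma$ containing the empty word $\epsilon$, closed under concatenation, and such that $cwr\in\mathcal W_\Sigma$ whenever $w\in\mathcal W_\Sigma$, $c\in\Sigma_c$, $r\in\Sigma_r$. Every nonempty $w\in\mathcal W_\Sigma$ decomposes uniquely as $w=cw_1rw_2$ with $c\in\Sigma_c$, $r\in\Sigma_r$, $w_1,w_2\in\mathcal W_\Sigma$. **First-child next-sibling encoding.** The map $\mathrm{fcns}:\mathcal W_\Sigma\to\mathcal W_{\Sigma_\bot}$ is defined by $\mathrm{fcns}(\epsilon)=\bot_c\bot_r$ and $\mathrm{fcns}(cw_1rw_2)=c\,\mathrm{fcns}(w_1)\,\mathrm{fcns}(w_2)\,r$. **Hedges.** For a finite alphabet $\Lambda$, the set $\mathcal H_\Lambda$ of hedges over $\Lambda$ is the set of finite ordered sequences of unranked ordered $\Lambda$-labelled trees: a hedge is either the empty hedge $0$ or is uniquely of the form $f(h_1)\cdot h_2$ with $f\in\Lambda$ and $h_1,h_2\in\mathcal H_\Lambda$ (here $\cdot$ is associative concatenation with unit $0$). The map $\mathrm{hedge}:\mathcal W_\Sigma\to\mathcal H_{\Sigma_c\times\Sigma_r}$ is defined by $\mathrm{hedge}(\epsilon)=0$ and $\mathrm{hedge}(cw_1rw_2)=(c,r)(\mathrm{hedge}(w_1))\cdot\mathrm{hedge}(w_2)$.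 **Visibly pushdown transducers.** A visibly pushdown transducer from a structured alphabet $\Sigma$ to $\Delta$ (applied in the claim with $\Sigma_\bot$ in place of $\Sigma$) is a tuple $A=(Q,I,F,\Gamma,\delta)$ with $Q$ a finite set of states, $I,F\subseteq Q$ the initial and final states, $\Gamma$ a finite stack alphabet, $\bot\notin\Gamma$ the bottom stack symbol, and $\delta=\delta_c\uplus\delta_r$ finite, where $\delta_c\subseteq Q\times\Sigma_c\times\Gamma\times\Delta^*\times Q$ (call transitions) and $\delta_r\subseteq Q\times\Sigma_r\times\Gamma\times\Delta^*\times Q$ (return transitions). A configuration is a pair $(q,\sigma)$ with $q\in Q$, $\sigma\in\bot\Gamma^*$. A call transition $(q,a,\gamma,v,q')$ reads $a$, outputs $v$, and goes from $(q,\sigma)$ to $(q',\sigma\gamma)$; a return transition $(q,a,\gamma,v,q')$ reads $a$, outputs $v$, and goes from $(q,\sigma\gamma)$ to $(q',\sigma)$. A run on a word is a sequence of transitions reading its letters in order; its output is the concatenation of the outputs of its transitions ($\epsilon$ for the empty run). A run is accepting if it goes from some $(q,\bot)$ with $q\in I$ to some $(q',\bot)$ with $q'\in F$. $A$ is identified with the relation of pairs $(u,v)$ such that there is an accepting run on $u$ with output $v$. **Hedge-to-string transducers.** A hedge-to-string transducer from $\Lambda$ to $\Delta$ is a tuple $T=(Q,I,\delta)$ with $Q$ a finite set of states, $I\subseteq Q$ the initial states, and $\delta$ a finite set of rules of the forms $$q(0)\to\epsilon,\qquad q(f(x_1)\cdot x_2)\to w_1q_1(x_1)w_2q_2(x_2)w_3,$$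 with $q,q_1,q_2\in Q$, $f\in\Lambda$, $w_1,w_2,w_3\in\Delta^*$. Its semantics is given by maps $[\![q]\!]:\mathcal H_\Lambda\to 2^{\Delta^*}$: $[\![q]\!](0)=\{\epsilon\}$ if $q(0)\to\epsilon\in\delta$ and $\emptyset$ otherwise; $[\![q]\!](f(h)\cdot h')$ is the union, over all rules $q(f(x_1)\cdot x_2)\to w_1q_1(x_1)w_2q_2(x_2)w_3$ in $\delta$, of $w_1\cdot[\![q_1]\!](h)\cdot w_2\cdot[\![q_2]\!](h')\cdot w_3$. $T$ is identified with the relation $\{(h,s)\mid\exists q\in I,\ s\in[\![q]\!](h)\}$. A transducer accepts an input if the input is related to at least one output. $T\circ\mathrm{hedge}=\{(w,s)\mid w\in\mathcal W_\Sigma,\ (\mathrm{hedge}(w),s)\in T\}$ and $A\circ\mathrm{fcns}=\{(w,s)\mid w\in\mathcal W_\Sigma,\ (\mathrm{fcns}(w),s)\in A\}$. *)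

theory Defs
  imports Main
begin

definition structured_alphabet :: "'a set \<Rightarrow> 'a set \<Rightarrow> bool" where
  "structured_alphabet Sc Sr \<longleftrightarrow> finite Sc \<and> finite Sr \<and> Sc \<inter> Sr = {}"

inductive_set well_nested :: "'a set \<Rightarrow> 'a set \<Rightarrow> 'a list set" for Sc Sr where
  empty: "[] \<in> well_nested Sc Sr"
| append: "u \<in> well_nested Sc Sr \<Longrightarrow> v \<in> well_nested Sc Sr \<Longrightarrow> u @ v \<in> well_nested Sc Sr"
| nest: "w \<in> well_nested Sc Sr \<Longrightarrow> c \<in> Sc \<Longrightarrow> r \<in> Sr \<Longrightarrow> c # w @ [r] \<in> well_nested Sc Sr"

(* The maps fcns and hedge below are recursive along the unique decomposition
   w = c w1 r w2 of nonempty well-nested words. They are introduced through their graphs;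
   their recursion equations are the lemmas fcns_Nil, fcns_decomp, hedge_Nil, hedge_decomp.
   Outside the well-nested words their values are unspecified. *)

inductive fcns_graph :: "'a set \<Rightarrow> 'a set \<Rightarrow> 'a \<Rightarrow> 'a \<Rightarrow> 'a list \<Rightarrow> 'a list \<Rightarrow> bool"
  for Sc Sr botc botr where
  empty: "fcns_graph Sc Sr botc botr [] [botc, botr]"
| decomp: "c \<in> Sc \<Longrightarrow> r \<in> Sr \<Longrightarrow> fcns_graph Sc Sr botc botr w1 u1 \<Longrightarrow>
    fcns_graph Sc Sr botc botr w2 u2 \<Longrightarrow>
    fcns_graph Sc Sr botc botr (c # w1 @ r # w2) (c # u1 @ u2 @ [r])"

definition fcns :: "'a set \<Rightarrow> 'a set \<Rightarrow> 'a \<Rightarrow> 'a \<Rightarrow> 'a list \<Rightarrow> 'a list" where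
  "fcns Sc Sr botc botr w = (THE u. fcns_graph Sc Sr botc botr w u)"

datatype 'f tree = Node 'f "'f tree list"

type_synonym 'f hedge = "'f tree list"

definition hedges :: "'f set \<Rightarrow> 'f hedge set" where
  "hedges L = lists {t. set_tree t \<subseteq> L}"

inductive hedge_graph :: "'a set \<Rightarrow> 'a set \<Rightarrow> 'a list \<Rightarrow> ('a \<times> 'a) hedge \<Rightarrow> bool"
  for Sc Sr where
  empty: "hedge_graph Sc Sr [] []"
| decomp: "c \<in> Sc \<Longrightarrow> r \<in> Sr \<Longrightarrow> hedge_graph Sc Sr w1 h1 \<Longrightarrow> hedge_graph Sc Sr w2 h2 \<Longrightarrow>
    hedge_graph Sc Sr (c # w1 @ r # w2) (Node (c, r) h1 # h2)"

definition hedge :: "'a set \<Rightarrow> 'a set \<Rightarrow> 'a list \<Rightarrow> ('a \<times> 'a) hedge" where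
  "hedge Sc Sr w = (THE h. hedge_graph Sc Sr w h)"

lemma well_nested_decomp:
  assumes "c \<in> Sc" "r \<in> Sr" "w1 \<in> well_nested Sc Sr" "w2 \<in> well_nested Sc Sr"
  shows "c # w1 @ r # w2 \<in> well_nested Sc Sr"
  using well_nested.append[OF well_nested.nest[OF assms(3,1,2)] assms(4)] by simp

lemma well_nested_decomp_induct [consumes 1, case_names empty decomp]:
  assumes "w \<in> well_nested Sc Sr"
    and empty: "P []"
    and decomp: "\<And>c r w1 w2. c \<in> Sc \<Longrightarrow> r \<in> Sr \<Longrightarrow> w1 \<in> well_nested Sc Sr \<Longrightarrow>
      w2 \<in> well_nested Sc Sr \<Longrightarrow> P w1 \<Longrightarrow> P w2 \<Longrightarrow> P (c # w1 @ r # w2)"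
  shows "P w"
proof -
  have "\<forall>v. v \<in> well_nested Sc Sr \<longrightarrow> P v \<longrightarrow> P (w @ v)"
    using assms(1)
  proof induction
    case (append u v)
    then show ?case by (auto intro: well_nested.append)
  next
    case (nest w c r)
    have "P w"
      using nest.IH empty well_nested.empty by (metis append_Nil2)
    then show ?case
      using decomp nest.hyps by auto
  qed simp
  then show ?thesis
    using empty well_nested.empty by (metis append_Nil2)
qed

lemma well_nested_decomp_exists:
  assumes "w \<in> well_nested Sc Sr" "w \<noteq> []"
  obtains c r w1 w2 where "w = c # w1 @ r # w2" "c \<in> Sc" "r \<in> Sr"
    "w1 \<in> well_nested Sc Sr" "w2 \<in> well_nested Sc Sr"
  using assms by (induction rule: well_nested_decomp_induct) auto

lemma well_nested_return_unique:
  assumes disj: "Sc \<inter> Sr = {}"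
    and "w1 \<in> well_nested Sc Sr" "v1 \<in> well_nested Sc Sr" "r \<in> Sr" "s \<in> Sr"
    and "w1 @ r # w2 = v1 @ s # v2"
  shows "w1 = v1 \<and> r = s \<and> w2 = v2"
  using assms(2-)
proof (induction w1 arbitrary: v1 r s w2 v2 rule: well_nested_decomp_induct)
  case empty
  have "v1 = []"
  proof (rule ccontr)
    assume "v1 \<noteq> []"
    then obtain c v where "v1 = c # v" "c \<in> Sc"
      using empty.prems(1) by (blast elim: well_nested_decomp_exists)
    then show False using empty.prems disj by auto
  qed
  then show ?case using empty.prems by simp
next
  case (decomp c r' x1 x2)
  have "v1 \<noteq> []" using decomp.prems decomp.hyps disj by auto
  then obtain c' s' y1 y2 where v1: "v1 = c' # y1 @ s' # y2" "s' \<in> Sr"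
      "y1 \<in> well_nested Sc Sr" "y2 \<in> well_nested Sc Sr"
    using decomp.prems(1) by (blast elim: well_nested_decomp_exists)
  have "x1 @ r' # (x2 @ r # w2) = y1 @ s' # (y2 @ s # v2)" and c: "c = c'"
    using decomp.prems(4) v1 by auto
  then have "x1 = y1 \<and> r' = s' \<and> x2 @ r # w2 = y2 @ s # v2"
    using decomp.IH(1) decomp.hyps(2) v1 by blast
  moreover from this have "x2 = y2 \<and> r = s \<and> w2 = v2"
    using decomp.IH(2) decomp.prems(2,3) v1 by blast
  ultimately show ?case using v1 c by auto
qed

lemma well_nested_decomp_unique:
  assumes "Sc \<inter> Sr = {}"
    and "w1 \<in> well_nested Sc Sr" "v1 \<in> well_nested Sc Sr" "r \<in> Sr" "s \<in> Sr"
    and "c # w1 @ r # w2 = d # v1 @ s # v2"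
  shows "c = d \<and> w1 = v1 \<and> r = s \<and> w2 = v2"
  using well_nested_return_unique[OF assms(1-5)] assms(6) by auto

lemma fcns_graph_well_nested:
  "fcns_graph Sc Sr botc botr w u \<Longrightarrow> w \<in> well_nested Sc Sr"
  by (induction rule: fcns_graph.induct) (auto intro: well_nested_decomp well_nested.empty)

lemma hedge_graph_well_nested: "hedge_graph Sc Sr w h \<Longrightarrow> w \<in> well_nested Sc Sr"
  by (induction rule: hedge_graph.induct) (auto intro: well_nested_decomp well_nested.empty)

lemma fcns_graph_unique:
  assumes disj: "Sc \<inter> Sr = {}"
  shows "fcns_graph Sc Sr botc botr w u \<Longrightarrow> fcns_graph Sc Sr botc botr w u' \<Longrightarrow> u = u'"
proof (induction arbitrary: u' rule: fcns_graph.induct)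
  case empty
  then show ?case by cases auto
next
  case (decomp c r w1 u1 w2 u2)
  from decomp.prems obtain c' r' v1 x1 v2 x2 where
    eq: "c # w1 @ r # w2 = c' # v1 @ r' # v2" "u' = c' # x1 @ x2 @ [r']" and "r' \<in> Sr"
    and graph: "fcns_graph Sc Sr botc botr v1 x1" "fcns_graph Sc Sr botc botr v2 x2"
    by (cases rule: fcns_graph.cases) auto
  have "c = c' \<and> w1 = v1 \<and> r = r' \<and> w2 = v2"
    using fcns_graph_well_nested[OF decomp.hyps(3)] fcns_graph_well_nested[OF graph(1)]
      decomp.hyps(2) \<open>r' \<in> Sr\<close> eq(1) by (rule well_nested_decomp_unique[OF disj])
  then show ?case using decomp.IH graph eq(2) by blast
qed

lemma hedge_graph_unique:
  assumes disj: "Sc \<inter> Sr = {}"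
  shows "hedge_graph Sc Sr w h \<Longrightarrow> hedge_graph Sc Sr w h' \<Longrightarrow> h = h'"
proof (induction arbitrary: h' rule: hedge_graph.induct)
  case empty
  then show ?case by cases auto
next
  case (decomp c r w1 h1 w2 h2)
  from decomp.prems obtain c' r' v1 x1 v2 x2 where
    eq: "c # w1 @ r # w2 = c' # v1 @ r' # v2" "h' = Node (c', r') x1 # x2" and "r' \<in> Sr"
    and graph: "hedge_graph Sc Sr v1 x1" "hedge_graph Sc Sr v2 x2"
    by (cases rule: hedge_graph.cases) auto
  have "c = c' \<and> w1 = v1 \<and> r = r' \<and> w2 = v2"
    using hedge_graph_well_nested[OF decomp.hyps(3)] hedge_graph_well_nested[OF graph(1)]
      decomp.hyps(2) \<open>r' \<in> Sr\<close> eq(1) by (rule well_nested_decomp_unique[OF disj])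
  then show ?case using decomp.IH graph eq(2) by blast
qed

lemma fcns_eqI:
  "Sc \<inter> Sr = {} \<Longrightarrow> fcns_graph Sc Sr botc botr w u \<Longrightarrow> fcns Sc Sr botc botr w = u"
  unfolding fcns_def by (blast intro: fcns_graph_unique)

lemma hedge_eqI: "Sc \<inter> Sr = {} \<Longrightarrow> hedge_graph Sc Sr w h \<Longrightarrow> hedge Sc Sr w = h"
  unfolding hedge_def by (blast intro: hedge_graph_unique)

lemma fcns_graph_fcns:
  assumes "Sc \<inter> Sr = {}" "w \<in> well_nested Sc Sr"
  shows "fcns_graph Sc Sr botc botr w (fcns Sc Sr botc botr w)"
proof -
  have "\<exists>u. fcns_graph Sc Sr botc botr w u"
    using assms(2) by (induction rule: well_nested_decomp_induct) (blast intro: fcns_graph.intros)+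
  then show ?thesis using fcns_eqI[OF assms(1)] by metis
qed

lemma hedge_graph_hedge:
  assumes "Sc \<inter> Sr = {}" "w \<in> well_nested Sc Sr"
  shows "hedge_graph Sc Sr w (hedge Sc Sr w)"
proof -
  have "\<exists>h. hedge_graph Sc Sr w h"
    using assms(2) by (induction rule: well_nested_decomp_induct) (blast intro: hedge_graph.intros)+
  then show ?thesis using hedge_eqI[OF assms(1)] by metis
qed

lemma fcns_Nil: "Sc \<inter> Sr = {} \<Longrightarrow> fcns Sc Sr botc botr [] = [botc, botr]"
  by (blast intro: fcns_eqI fcns_graph.empty)

lemma fcns_decomp:
  assumes "Sc \<inter> Sr = {}" "c \<in> Sc" "r \<in> Sr" "w1 \<in> well_nested Sc Sr" "w2 \<in> well_nested Sc Sr"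
  shows "fcns Sc Sr botc botr (c # w1 @ r # w2) =
    c # fcns Sc Sr botc botr w1 @ fcns Sc Sr botc botr w2 @ [r]"
  using assms by (blast intro: fcns_eqI fcns_graph.decomp fcns_graph_fcns)

lemma hedge_Nil: "Sc \<inter> Sr = {} \<Longrightarrow> hedge Sc Sr [] = []"
  by (blast intro: hedge_eqI hedge_graph.empty)

lemma hedge_decomp:
  assumes "Sc \<inter> Sr = {}" "c \<in> Sc" "r \<in> Sr" "w1 \<in> well_nested Sc Sr" "w2 \<in> well_nested Sc Sr"
  shows "hedge Sc Sr (c # w1 @ r # w2) = Node (c, r) (hedge Sc Sr w1) # hedge Sc Sr w2"
  using assms by (blast intro: hedge_eqI hedge_graph.decomp hedge_graph_hedge)

lemma fcns_well_nested:
  assumes "Sc \<inter> Sr = {}" "w \<in> well_nested Sc Sr"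
  shows "fcns Sc Sr botc botr w \<in> well_nested (insert botc Sc) (insert botr Sr)"
  using assms(2)
proof (induction rule: well_nested_decomp_induct)
  case empty
  then show ?case
    using well_nested.nest[OF well_nested.empty, of botc "insert botc Sc" botr "insert botr Sr"]
    by (simp add: fcns_Nil[OF assms(1)])
next
  case (decomp c r w1 w2)
  then show ?case
    using well_nested.nest[OF well_nested.append[OF decomp(5,6)], of c r]
    by (simp add: fcns_decomp[OF assms(1)])
qed

lemma hedge_in_hedges:
  assumes "Sc \<inter> Sr = {}" "w \<in> well_nested Sc Sr"
  shows "hedge Sc Sr w \<in> hedges (Sc \<times> Sr)"
  using assms(2)
  by (induction rule: well_nested_decomp_induct)
    (auto simp: hedge_Nil hedge_decomp assms(1) hedges_def in_lists_conv_set)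

record ('q, 'g, 'a, 'd) vpt =
  vpt_states :: "'q set"
  vpt_initial :: "'q set"
  vpt_final :: "'q set"
  vpt_stack :: "'g set"
  vpt_bottom :: 'g
  vpt_calls :: "('q \<times> 'a \<times> 'g \<times> 'd list \<times> 'q) set"
  vpt_returns :: "('q \<times> 'a \<times> 'g \<times> 'd list \<times> 'q) set"

definition is_vpt :: "'a set \<Rightarrow> 'a set \<Rightarrow> 'd set \<Rightarrow> ('q, 'g, 'a, 'd) vpt \<Rightarrow> bool" where
  "is_vpt Sc Sr D A \<longleftrightarrow>
    finite (vpt_states A) \<and> vpt_initial A \<subseteq> vpt_states A \<and> vpt_final A \<subseteq> vpt_states A \<and>
    finite (vpt_stack A) \<and> vpt_bottom A \<notin> vpt_stack A \<and>
    finite (vpt_calls A) \<and>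
    vpt_calls A \<subseteq> vpt_states A \<times> Sc \<times> vpt_stack A \<times> lists D \<times> vpt_states A \<and>
    finite (vpt_returns A) \<and>
    vpt_returns A \<subseteq> vpt_states A \<times> Sr \<times> vpt_stack A \<times> lists D \<times> vpt_states A"

(* The top of the stack is the last element of the list. *)
definition vpt_configs :: "('q, 'g, 'a, 'd) vpt \<Rightarrow> ('q \<times> 'g list) set" where
  "vpt_configs A = {(q, vpt_bottom A # \<sigma>) | q \<sigma>. q \<in> vpt_states A \<and> \<sigma> \<in> lists (vpt_stack A)}"

inductive vpt_step ::
  "('q, 'g, 'a, 'd) vpt \<Rightarrow> 'q \<times> 'g list \<Rightarrow> 'a \<Rightarrow> 'd list \<Rightarrow> 'q \<times> 'g list \<Rightarrow> bool" for A where
  call: "(q, \<sigma>) \<in> vpt_configs A \<Longrightarrow> (q, a, \<gamma>, v, q') \<in> vpt_calls A \<Longrightarrow>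
    vpt_step A (q, \<sigma>) a v (q', \<sigma> @ [\<gamma>])"
| ret: "(q, \<sigma> @ [\<gamma>]) \<in> vpt_configs A \<Longrightarrow> (q, a, \<gamma>, v, q') \<in> vpt_returns A \<Longrightarrow>
    vpt_step A (q, \<sigma> @ [\<gamma>]) a v (q', \<sigma>)"

inductive vpt_run ::
  "('q, 'g, 'a, 'd) vpt \<Rightarrow> 'q \<times> 'g list \<Rightarrow> 'a list \<Rightarrow> 'd list \<Rightarrow> 'q \<times> 'g list \<Rightarrow> bool" for A where
  empty: "k \<in> vpt_configs A \<Longrightarrow> vpt_run A k [] [] k"
| step: "vpt_step A k a v k' \<Longrightarrow> vpt_run A k' u w k'' \<Longrightarrow> vpt_run A k (a # u) (v @ w) k''"

definition vpt_rel :: "('q, 'g, 'a, 'd) vpt \<Rightarrow> ('a list \<times> 'd list) set" where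
  "vpt_rel A = {(u, v). \<exists>q \<in> vpt_initial A. \<exists>q' \<in> vpt_final A.
    vpt_run A (q, [vpt_bottom A]) u v (q', [vpt_bottom A])}"

(* A rule q(0) -> epsilon is represented by membership of q in hst_empty_rules, and a rule
   q(f(x1) x2) -> w1 q1(x1) w2 q2(x2) w3 by the tuple (q, f, w1, q1, w2, q2, w3). *)
record ('q, 'f, 'd) hst =
  hst_states :: "'q set"
  hst_initial :: "'q set"
  hst_empty_rules :: "'q set"
  hst_rules :: "('q \<times> 'f \<times> 'd list \<times> 'q \<times> 'd list \<times> 'q \<times> 'd list) set"

definition is_hst :: "'f set \<Rightarrow> 'd set \<Rightarrow> ('q, 'f, 'd) hst \<Rightarrow> bool" where
  "is_hst L D T \<longleftrightarrow>
    finite (hst_states T) \<and> hst_initial T \<subseteq> hst_states T \<and>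
    hst_empty_rules T \<subseteq> hst_states T \<and>
    finite (hst_rules T) \<and>
    hst_rules T \<subseteq>
      hst_states T \<times> L \<times> lists D \<times> hst_states T \<times> lists D \<times> hst_states T \<times> lists D"

fun hst_sem :: "('q, 'f, 'd) hst \<Rightarrow> 'q \<Rightarrow> 'f hedge \<Rightarrow> 'd list set" where
  "hst_sem T q [] = (if q \<in> hst_empty_rules T then {[]} else {})"
| "hst_sem T q (Node f h # h') =
    {w1 @ s1 @ w2 @ s2 @ w3 | w1 q1 s1 w2 q2 s2 w3.
      (q, f, w1, q1, w2, q2, w3) \<in> hst_rules T \<and> s1 \<in> hst_sem T q1 h \<and> s2 \<in> hst_sem T q2 h'}"

definition hst_rel :: "('q, 'f, 'd) hst \<Rightarrow> ('f hedge \<times> 'd list) set" where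
  "hst_rel T = {(h, s). \<exists>q \<in> hst_initial T. s \<in> hst_sem T q h}"

(* The relation is restricted to hedges over the input alphabet by the rules alone. *)
lemma hst_rel_subset:
  assumes "is_hst L D T"
  shows "hst_rel T \<subseteq> hedges L \<times> lists D"
proof -
  have rules: "f \<in> L \<and> w1 \<in> lists D \<and> w2 \<in> lists D \<and> w3 \<in> lists D"
    if "(q, f, w1, q1, w2, q2, w3) \<in> hst_rules T" for q f w1 q1 w2 q2 w3
    using assms that unfolding is_hst_def by blast
  have "h \<in> hedges L \<and> s \<in> lists D" if "s \<in> hst_sem T q h" for s q h
    using that rules
  proof (induction T q h arbitrary: s rule: hst_sem.induct)
    case (1 T q)
    then show ?case by (auto simp: hedges_def split: if_splits)
  next
    case (2 T q f h h')
    from "2.prems"(1) obtain w1 q1 s1 w2 q2 s2 w3 where s: "s = w1 @ s1 @ w2 @ s2 @ w3"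
      and rule: "(q, f, w1, q1, w2, q2, w3) \<in> hst_rules T"
      and sem: "s1 \<in> hst_sem T q1 h" "s2 \<in> hst_sem T q2 h'"
      by auto
    have "h \<in> hedges L \<and> s1 \<in> lists D" "h' \<in> hedges L \<and> s2 \<in> lists D"
      using "2.IH"(1)[OF sem(1)] "2.IH"(2)[OF sem(2)] "2.prems"(2) by blast+
    moreover have "f \<in> L \<and> w1 \<in> lists D \<and> w2 \<in> lists D \<and> w3 \<in> lists D"
      using "2.prems"(2)[OF rule] .
    ultimately show ?case
      by (auto simp: s hedges_def in_lists_conv_set)
  qed
  then show ?thesis
    by (auto simp: hst_rel_def)
qed

definition precompose :: "'w set \<Rightarrow> ('w \<Rightarrow> 'x) \<Rightarrow> ('x \<times> 's) set \<Rightarrow> ('w \<times> 's) set" where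
  "precompose W f R = {(w, s). w \<in> W \<and> (f w, s) \<in> R}"

end

(* On the encoding c fcns(w1) fcns(w2) r of a nonempty word, a stack-neutral run of a visibly
   pushdown transducer consists of a call transition, a neutral run on fcns(w1), a neutral run on
   fcns(w2) and a return transition popping the symbol pushed first. Hence a hedge-to-string
   transducer can simulate it with pairs of states (source, target). A leaf is encoded by botc botr
   and may produce output, whereas q(0) -> epsilon may not; so the state additionally carries a
   guess whether the hedge is empty and, if so, which output its leaf produces, and this output is
   written by the parent. The root needs no such output because the empty hedge is not accepted.

   Conversely, a pushdown transducer evaluates a hedge in state q by remembering in its control
   state which rule it is in, and whether it is evaluating x1 or x2 of that rule. Each such control
   state determines q and the control state to continue with afterwards; it is pushed on the stack
   at the call and looked up at the matching return. The output w2 is delayed until x2 is entered. *)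

theory Submission imports Defs begin

section \<open>Structural induction on hedges\<close>

lemma Nil_in_hedges [simp]: "[] \<in> hedges L"
  by (simp add: hedges_def)

lemma Cons_in_hedges [simp]:
  "Node f h # h' \<in> hedges L \<longleftrightarrow> f \<in> L \<and> h \<in> hedges L \<and> h' \<in> hedges L"
  by (auto simp: hedges_def in_lists_conv_set)

lemma hedges_induct [consumes 1, case_names empty node]:
  assumes "h \<in> hedges L"
    and empty: "P []"
    and node: "\<And>f h h'. f \<in> L \<Longrightarrow> h \<in> hedges L \<Longrightarrow> h' \<in> hedges L \<Longrightarrow> P h \<Longrightarrow> P h' \<Longrightarrow>
      P (Node f h # h')"
  shows "P h"
  using assms(1)
proof (induction "size_list size h" arbitrary: h rule: less_induct)
  case less
  show ?case
  proof (cases h)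
    case Nil
    then show ?thesis using empty by simp
  next
    case (Cons t h2)
    obtain f h1 where t: "t = Node f h1" by (cases t)
    show ?thesis
      using less.prems unfolding Cons t
      by (intro node less.hyps) (auto simp: Cons t)
  qed
qed

section \<open>Neutral runs on encodings\<close>

text \<open>No stack appears: a run that starts and ends at the same level never looks below it, so
  the only trace of the stack is that matching call and return share \<gamma>. Recursing over the
  hedge instead of the encoded word gives a form directly comparable with
  \<open>hst_sem\<close>.\<close>

fun neutral_run ::
  "'a \<Rightarrow> 'a \<Rightarrow> ('q, 'g, 'a, 'd) vpt \<Rightarrow> 'q \<Rightarrow> ('a \<times> 'a) hedge \<Rightarrow> 'd list \<Rightarrow> 'q \<Rightarrow> bool" where
  "neutral_run botc botr A p [] v q \<longleftrightarrow> (\<exists>\<gamma> m v1 v2.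
    (p, botc, \<gamma>, v1, m) \<in> vpt_calls A \<and> (m, botr, \<gamma>, v2, q) \<in> vpt_returns A \<and> v = v1 @ v2)"
| "neutral_run botc botr A p (Node (c, r) h # h') v q \<longleftrightarrow> (\<exists>\<gamma> p' m q' v1 s1 s2 v2.
    (p, c, \<gamma>, v1, p') \<in> vpt_calls A \<and> neutral_run botc botr A p' h s1 m \<and>
    neutral_run botc botr A m h' s2 q' \<and> (q', r, \<gamma>, v2, q) \<in> vpt_returns A \<and>
    v = v1 @ s1 @ s2 @ v2)"

lemma is_vpt_callD:
  assumes "is_vpt Sc Sr D A" "(p, a, \<gamma>, v, q) \<in> vpt_calls A"
  shows "p \<in> vpt_states A" "a \<in> Sc" "\<gamma> \<in> vpt_stack A" "v \<in> lists D" "q \<in> vpt_states A"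
  using assms unfolding is_vpt_def by blast+

lemma is_vpt_returnD:
  assumes "is_vpt Sc Sr D A" "(p, a, \<gamma>, v, q) \<in> vpt_returns A"
  shows "p \<in> vpt_states A" "a \<in> Sr" "\<gamma> \<in> vpt_stack A" "v \<in> lists D" "q \<in> vpt_states A"
  using assms unfolding is_vpt_def by blast+

lemma neutral_run_states:
  assumes "is_vpt Sc Sr D A" "neutral_run botc botr A p h v q"
  shows "p \<in> vpt_states A" "q \<in> vpt_states A"
  using assms(2)
  by (cases "(botc, botr, A, p, h, v, q)" rule: neutral_run.cases;
      auto dest: is_vpt_callD(1)[OF assms(1)] is_vpt_returnD(5)[OF assms(1)])+

lemma vpt_run_append:
  "vpt_run A k u v k' \<Longrightarrow> vpt_run A k' u' v' k'' \<Longrightarrow> vpt_run A k (u @ u') (v @ v') k''"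
  by (induction rule: vpt_run.induct) (auto intro: vpt_run.step)

lemma config_change_state:
  "(p, \<sigma>) \<in> vpt_configs A \<Longrightarrow> q \<in> vpt_states A \<Longrightarrow> (q, \<sigma>) \<in> vpt_configs A"
  by (auto simp: vpt_configs_def)

lemma config_push:
  "(p, \<sigma>) \<in> vpt_configs A \<Longrightarrow> q \<in> vpt_states A \<Longrightarrow> \<gamma> \<in> vpt_stack A \<Longrightarrow>
    (q, \<sigma> @ [\<gamma>]) \<in> vpt_configs A"
  by (auto simp: vpt_configs_def)

lemma vpt_run_nest:
  assumes A: "is_vpt Sc Sr D A" and p: "(p, \<sigma>) \<in> vpt_configs A"
    and call: "(p, a, \<gamma>, v1, p') \<in> vpt_calls A"
    and run: "vpt_run A (p', \<sigma> @ [\<gamma>]) u s (q', \<sigma> @ [\<gamma>])"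
    and ret: "(q', b, \<gamma>, v2, q) \<in> vpt_returns A"
  shows "vpt_run A (p, \<sigma>) (a # u @ [b]) (v1 @ s @ v2) (q, \<sigma>)"
proof -
  have "(q', \<sigma> @ [\<gamma>]) \<in> vpt_configs A" "(q, \<sigma>) \<in> vpt_configs A"
    using config_push[OF p] config_change_state[OF p] is_vpt_returnD[OF A ret] by auto
  then have "vpt_run A (q', \<sigma> @ [\<gamma>]) [b] (v2 @ []) (q, \<sigma>)"
    using ret by (blast intro: vpt_run.intros vpt_step.ret)
  then have "vpt_run A (p', \<sigma> @ [\<gamma>]) (u @ [b]) (s @ v2) (q, \<sigma>)"
    using vpt_run_append[OF run] by simp
  then show ?thesis
    using vpt_run.step[OF vpt_step.call[OF p call]] by simp
qed

text \<open>The stack \<sigma> is generalised because the runs on the two subencodings take place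
  above the symbol pushed by the enclosing call.\<close>

lemma vpt_run_fcns_neutral:
  assumes A: "is_vpt Sc' Sr' D A" and disj: "Sc \<inter> Sr = {}"
    and "w \<in> well_nested Sc Sr"
    and "neutral_run botc botr A p (hedge Sc Sr w) v q" "(p, \<sigma>) \<in> vpt_configs A"
  shows "vpt_run A (p, \<sigma>) (fcns Sc Sr botc botr w) v (q, \<sigma>)"
  using assms(3-)
proof (induction w arbitrary: p v q \<sigma> rule: well_nested_decomp_induct)
  case empty
  then obtain \<gamma> m v1 v2 where call: "(p, botc, \<gamma>, v1, m) \<in> vpt_calls A"
    and ret: "(m, botr, \<gamma>, v2, q) \<in> vpt_returns A" and v: "v = v1 @ v2"
    by (auto simp: hedge_Nil[OF disj])
  have "vpt_run A (m, \<sigma> @ [\<gamma>]) [] [] (m, \<sigma> @ [\<gamma>])"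
    using config_push[OF empty.prems(2)] is_vpt_callD[OF A call] by (auto intro: vpt_run.empty)
  from vpt_run_nest[OF A empty.prems(2) call this ret] show ?case
    by (simp add: v fcns_Nil[OF disj])
next
  case (decomp c r w1 w2)
  obtain \<gamma> p' m q' v1 s1 s2 v2 where call: "(p, c, \<gamma>, v1, p') \<in> vpt_calls A"
    and run: "neutral_run botc botr A p' (hedge Sc Sr w1) s1 m"
      "neutral_run botc botr A m (hedge Sc Sr w2) s2 q'"
    and ret: "(q', r, \<gamma>, v2, q) \<in> vpt_returns A" and v: "v = v1 @ s1 @ s2 @ v2"
    using decomp.prems(1) by (auto simp: hedge_decomp[OF disj decomp.hyps])
  have p': "(p', \<sigma> @ [\<gamma>]) \<in> vpt_configs A"
    using config_push[OF decomp.prems(2)] is_vpt_callD[OF A call] by auto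
  then have "(m, \<sigma> @ [\<gamma>]) \<in> vpt_configs A"
    using config_change_state neutral_run_states(2)[OF A run(1)] by metis
  with p' have "vpt_run A (p', \<sigma> @ [\<gamma>])
      (fcns Sc Sr botc botr w1 @ fcns Sc Sr botc botr w2) (s1 @ s2) (q', \<sigma> @ [\<gamma>])"
    using decomp.IH run vpt_run_append by metis
  from vpt_run_nest[OF A decomp.prems(2) call this ret] show ?case
    by (simp add: v fcns_decomp[OF disj decomp.hyps])
qed

text \<open>Visibility: since call and return letters are disjoint, the letter read decides whether
  the step pushes or pops.\<close>

lemma vpt_step_callE:
  assumes "is_vpt Sc Sr D A" "Sc \<inter> Sr = {}" "a \<in> Sc" "vpt_step A (p, \<sigma>) a v k"
  obtains \<gamma> p' where "k = (p', \<sigma> @ [\<gamma>])" "(p, a, \<gamma>, v, p') \<in> vpt_calls A"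
  using assms(4)
  by cases (use assms(1-3) in \<open>auto dest: is_vpt_returnD(2)\<close>)

lemma vpt_step_returnE:
  assumes "is_vpt Sc Sr D A" "Sc \<inter> Sr = {}" "a \<in> Sr" "vpt_step A (p, \<sigma> @ [\<gamma>]) a v k"
  obtains p' where "k = (p', \<sigma>)" "(p, a, \<gamma>, v, p') \<in> vpt_returns A"
  using assms(4)
  by cases (use assms(1-3) in \<open>auto dest: is_vpt_callD(2)\<close>)

lemma vpt_run_ConsE:
  assumes "vpt_run A k (a # u) v k''"
  obtains v1 v2 k' where "v = v1 @ v2" "vpt_step A k a v1 k'" "vpt_run A k' u v2 k''"
  using assms by cases auto

text \<open>The suffix \<open>x\<close> makes the induction work: inside a larger encoding, that of
  \<open>w1\<close> is followed by further letters. Since the letters fix the pushes and pops, the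
  run is back at stack \<sigma> exactly when the encoding has been read.\<close>

lemma vpt_run_fcns_split:
  assumes A: "is_vpt (insert botc Sc) (insert botr Sr) D A"
    and disj: "Sc \<inter> Sr = {}" and disj': "insert botc Sc \<inter> insert botr Sr = {}"
    and "w \<in> well_nested Sc Sr"
    and "vpt_run A (p, \<sigma>) (fcns Sc Sr botc botr w @ x) v k"
  obtains q v1 v2 where "v = v1 @ v2" "neutral_run botc botr A p (hedge Sc Sr w) v1 q"
    "vpt_run A (q, \<sigma>) x v2 k"
proof -
  have "\<exists>q v1 v2. v = v1 @ v2 \<and> neutral_run botc botr A p (hedge Sc Sr w) v1 q \<and>
      vpt_run A (q, \<sigma>) x v2 k"
    using assms(4,5)
  proof (induction w arbitrary: p v \<sigma> x rule: well_nested_decomp_induct)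
    case empty
    then have "vpt_run A (p, \<sigma>) (botc # botr # x) v k"
      by (simp add: fcns_Nil[OF disj])
    then obtain v1 v2 v3 k1 k2 where "v = v1 @ v2 @ v3"
      and "vpt_step A (p, \<sigma>) botc v1 k1" "vpt_step A k1 botr v2 k2" "vpt_run A k2 x v3 k"
      by (metis vpt_run_ConsE)
    moreover from this obtain \<gamma> m where "k1 = (m, \<sigma> @ [\<gamma>])" "(p, botc, \<gamma>, v1, m) \<in> vpt_calls A"
      by (metis vpt_step_callE[OF A disj'] insertI1)
    moreover from calculation obtain q where "k2 = (q, \<sigma>)" "(m, botr, \<gamma>, v2, q) \<in> vpt_returns A"
      by (metis vpt_step_returnE[OF A disj'] insertI1)
    ultimately show ?case
      by (auto simp: hedge_Nil[OF disj]) (metis append_assoc)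
  next
    case (decomp c r w1 w2)
    let ?e = "fcns Sc Sr botc botr"
    have "vpt_run A (p, \<sigma>) (c # ?e w1 @ ?e w2 @ r # x) v k"
      using decomp.prems by (simp add: fcns_decomp[OF disj decomp.hyps])
    then obtain v1 v' k1 where v: "v = v1 @ v'" and "vpt_step A (p, \<sigma>) c v1 k1"
      and run: "vpt_run A k1 (?e w1 @ ?e w2 @ r # x) v' k"
      by (rule vpt_run_ConsE)
    then obtain \<gamma> p' where k1: "k1 = (p', \<sigma> @ [\<gamma>])" and call: "(p, c, \<gamma>, v1, p') \<in> vpt_calls A"
      using decomp.hyps(1) by (metis vpt_step_callE[OF A disj'] insertI2)
    \<comment> \<open>The hypothesis for \<open>w1\<close> is used with suffix
      \<open>?e w2 @ r # x\<close>, the one for \<open>w2\<close> below with suffix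
      \<open>r # x\<close>, both above the pushed \<gamma>.\<close>
    obtain m s1 v'' where v': "v' = s1 @ v''"
      and run1: "neutral_run botc botr A p' (hedge Sc Sr w1) s1 m"
      and run: "vpt_run A (m, \<sigma> @ [\<gamma>]) (?e w2 @ r # x) v'' k"
      using decomp.IH(1) run k1 by blast
    obtain q' s2 v3 where v'': "v'' = s2 @ v3"
      and run2: "neutral_run botc botr A m (hedge Sc Sr w2) s2 q'"
      and run: "vpt_run A (q', \<sigma> @ [\<gamma>]) (r # x) v3 k"
      using decomp.IH(2) run by blast
    \<comment> \<open>The stack is again \<open>\<sigma> @ [\<gamma>]\<close>, so reading
      \<open>r\<close> must pop the very symbol pushed when reading \<open>c\<close>.\<close>
    obtain v2 v4 k2 where v3: "v3 = v2 @ v4" and "vpt_step A (q', \<sigma> @ [\<gamma>]) r v2 k2"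
      and run: "vpt_run A k2 x v4 k"
      using run by (rule vpt_run_ConsE)
    then obtain q where k2: "k2 = (q, \<sigma>)" and ret: "(q', r, \<gamma>, v2, q) \<in> vpt_returns A"
      using decomp.hyps(2) by (metis vpt_step_returnE[OF A disj'] insertI2)
    have "neutral_run botc botr A p (hedge Sc Sr (c # w1 @ r # w2)) (v1 @ s1 @ s2 @ v2) q"
      unfolding hedge_decomp[OF disj decomp.hyps] neutral_run.simps
      using call run1 run2 ret by blast
    then show ?case
      using run unfolding k2 v v' v'' v3 by (metis append_assoc)
  qed
  then show thesis using that by blast
qed

lemma vpt_rel_fcns_iff:
  assumes A: "is_vpt (insert botc Sc) (insert botr Sr) D A"
    and disj: "Sc \<inter> Sr = {}" and disj': "insert botc Sc \<inter> insert botr Sr = {}"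
    and w: "w \<in> well_nested Sc Sr"
  shows "(fcns Sc Sr botc botr w, v) \<in> vpt_rel A \<longleftrightarrow>
    (\<exists>p \<in> vpt_initial A. \<exists>q \<in> vpt_final A. neutral_run botc botr A p (hedge Sc Sr w) v q)"
proof -
  have "vpt_run A (p, [vpt_bottom A]) (fcns Sc Sr botc botr w) v (q, [vpt_bottom A]) \<longleftrightarrow>
      neutral_run botc botr A p (hedge Sc Sr w) v q"
    if "p \<in> vpt_initial A" for p q
  proof
    assume "vpt_run A (p, [vpt_bottom A]) (fcns Sc Sr botc botr w) v (q, [vpt_bottom A])"
    then obtain q' v1 v2 where "v = v1 @ v2" "neutral_run botc botr A p (hedge Sc Sr w) v1 q'"
      "vpt_run A (q', [vpt_bottom A]) [] v2 (q, [vpt_bottom A])"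
      by (metis append_Nil2 vpt_run_fcns_split[OF A disj disj' w])
    then show "neutral_run botc botr A p (hedge Sc Sr w) v q"
      by (auto elim: vpt_run.cases)
  next
    assume "neutral_run botc botr A p (hedge Sc Sr w) v q"
    moreover have "(p, [vpt_bottom A]) \<in> vpt_configs A"
      using that A by (auto simp: vpt_configs_def is_vpt_def)
    ultimately show "vpt_run A (p, [vpt_bottom A]) (fcns Sc Sr botc botr w) v (q, [vpt_bottom A])"
      by (rule vpt_run_fcns_neutral[OF A disj w])
  qed
  then show ?thesis
    by (auto simp: vpt_rel_def)
qed

section \<open>Renaming of states and stack symbols\<close>

lemma ex_inj_on_nat: "finite S \<Longrightarrow> \<exists>e :: 'a \<Rightarrow> nat. inj_on e S"
  by (metis finite_imp_inj_to_nat_seg)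

text \<open>The constructions below build states out of the states and rules of the given
  transducer, whereas the theorem asks for natural numbers; finiteness provides an injection along
  which to rename.\<close>

definition rename_hst :: "('q \<Rightarrow> 'p) \<Rightarrow> ('q, 'f, 'd) hst \<Rightarrow> ('p, 'f, 'd) hst" where
  "rename_hst e T = \<lparr>hst_states = e ` hst_states T, hst_initial = e ` hst_initial T,
    hst_empty_rules = e ` hst_empty_rules T,
    hst_rules = (\<lambda>(q, f, w1, q1, w2, q2, w3). (e q, f, w1, e q1, w2, e q2, w3)) ` hst_rules T\<rparr>"

lemma is_hst_ruleD:
  assumes "is_hst L D T" "(q, f, w1, q1, w2, q2, w3) \<in> hst_rules T"
  shows "q \<in> hst_states T" "f \<in> L" "w1 \<in> lists D" "q1 \<in> hst_states T" "w2 \<in> lists D"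
    "q2 \<in> hst_states T" "w3 \<in> lists D"
  using assms unfolding is_hst_def by blast+

lemma is_hst_rename: "is_hst L D T \<Longrightarrow> is_hst L D (rename_hst e T)"
  unfolding is_hst_def rename_hst_def by (auto 0 3)

lemma hst_sem_rename:
  assumes T: "is_hst L D T" and e: "inj_on e (hst_states T)"
    and "h \<in> hedges L" "q \<in> hst_states T"
  shows "hst_sem (rename_hst e T) (e q) h = hst_sem T q h"
  using assms(3,4)
proof (induction h arbitrary: q rule: hedges_induct)
  case empty
  then have "e q \<in> e ` hst_empty_rules T \<longleftrightarrow> q \<in> hst_empty_rules T"
    using T e by (auto simp: is_hst_def dest: inj_onD)
  then show ?case
    by (simp add: rename_hst_def)
next
  case (node f h h')
  \<comment> \<open>Injectivity identifies the source as \<open>q\<close> itself, so renaming adds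
    no rules at \<open>e q\<close>; the targets \<open>x1\<close>, \<open>x2\<close> are images
    because only images occur in renamed rules.\<close>
  have rules: "(e q, f, w1, x1, w2, x2, w3) \<in> hst_rules (rename_hst e T) \<longleftrightarrow>
      (\<exists>q1 q2. x1 = e q1 \<and> x2 = e q2 \<and> (q, f, w1, q1, w2, q2, w3) \<in> hst_rules T)" for w1 x1 w2 x2 w3
    using node.prems is_hst_ruleD(1)[OF T] e
    by (force simp: rename_hst_def image_iff dest: inj_onD)
  show ?case
  proof (rule set_eqI)
    fix s
    have "s \<in> hst_sem (rename_hst e T) (e q) (Node f h # h') \<longleftrightarrow>
      (\<exists>w1 q1 s1 w2 q2 s2 w3. s = w1 @ s1 @ w2 @ s2 @ w3 \<and>
        (q, f, w1, q1, w2, q2, w3) \<in> hst_rules T \<and>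
        s1 \<in> hst_sem (rename_hst e T) (e q1) h \<and> s2 \<in> hst_sem (rename_hst e T) (e q2) h')"
      by (simp add: rules) blast
    also have "\<dots> \<longleftrightarrow> s \<in> hst_sem T q (Node f h # h')"
      using node.IH is_hst_ruleD(4,6)[OF T] by simp metis
    finally show "s \<in> hst_sem (rename_hst e T) (e q) (Node f h # h') \<longleftrightarrow>
      s \<in> hst_sem T q (Node f h # h')" .
  qed
qed

lemma hst_rel_rename:
  assumes T: "is_hst L D T" and e: "inj_on e (hst_states T)"
  shows "hst_rel (rename_hst e T) = hst_rel T"
proof -
  have "(h, s) \<in> hst_rel (rename_hst e T) \<longleftrightarrow> (h, s) \<in> hst_rel T" if h: "h \<in> hedges L" for h s
  proof -
    have "hst_initial T \<subseteq> hst_states T" using T by (simp add: is_hst_def)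
    then show ?thesis
      using hst_sem_rename[OF T e h] by (auto simp: hst_rel_def rename_hst_def)
  qed
  \<comment> \<open>Pairs whose hedge is not over \<open>L\<close> belong to neither
    relation.\<close>
  then show ?thesis
    using hst_rel_subset[OF T] hst_rel_subset[OF is_hst_rename[OF T, of e]] by auto
qed

section \<open>Renaming of pushdown transducers\<close>

definition rename_vpt ::
  "('q \<Rightarrow> 'p) \<Rightarrow> ('g \<Rightarrow> 'k) \<Rightarrow> ('q, 'g, 'a, 'd) vpt \<Rightarrow> ('p, 'k, 'a, 'd) vpt" where
  "rename_vpt e g A = \<lparr>vpt_states = e ` vpt_states A, vpt_initial = e ` vpt_initial A,
    vpt_final = e ` vpt_final A, vpt_stack = g ` vpt_stack A, vpt_bottom = g (vpt_bottom A),
    vpt_calls = (\<lambda>(q, a, \<gamma>, v, q'). (e q, a, g \<gamma>, v, e q')) ` vpt_calls A,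
    vpt_returns = (\<lambda>(q, a, \<gamma>, v, q'). (e q, a, g \<gamma>, v, e q')) ` vpt_returns A\<rparr>"

text \<open>Injectivity of \<open>g\<close> covers the bottom symbol too, so that its image stays
  outside the new stack alphabet.\<close>

lemma is_vpt_rename:
  assumes "is_vpt Sc Sr D A" "inj_on g (insert (vpt_bottom A) (vpt_stack A))"
  shows "is_vpt Sc Sr D (rename_vpt e g A)"
  using assms unfolding is_vpt_def rename_vpt_def by (auto 0 3)

lemma rename_call:
  "(p, a, \<gamma>, v, q) \<in> vpt_calls A \<Longrightarrow> (e p, a, g \<gamma>, v, e q) \<in> vpt_calls (rename_vpt e g A)"
  by (force simp: rename_vpt_def)

lemma rename_return:
  "(p, a, \<gamma>, v, q) \<in> vpt_returns A \<Longrightarrow>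
    (e p, a, g \<gamma>, v, e q) \<in> vpt_returns (rename_vpt e g A)"
  by (force simp: rename_vpt_def)

text \<open>A renamed run starting in an image state stays among images and lifts back step by step.
  Injectivity of \<open>e\<close> prevents transitions of different states from being glued
  together; injectivity of \<open>g\<close> prevents a return from popping a symbol pushed by an
  unrelated call.\<close>

lemma neutral_run_rename:
  assumes A: "is_vpt Sc Sr D A" and e: "inj_on e (vpt_states A)" and g: "inj_on g (vpt_stack A)"
    and "p \<in> vpt_states A"
  shows "neutral_run botc botr (rename_vpt e g A) (e p) h v y \<longleftrightarrow>
    (\<exists>q. y = e q \<and> neutral_run botc botr A p h v q)"
proof -
  have calls: "(e p, a, \<kappa>, v, y) \<in> vpt_calls (rename_vpt e g A) \<longleftrightarrow>
      (\<exists>\<gamma> q. \<kappa> = g \<gamma> \<and> y = e q \<and> (p, a, \<gamma>, v, q) \<in> vpt_calls A)"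
    if "p \<in> vpt_states A" for p a \<kappa> v y
    using that is_vpt_callD(1)[OF A] e
    by (force simp: rename_vpt_def image_iff dest: inj_onD)
  \<comment> \<open>Unlike in \<open>calls\<close>, the stack symbol is given here as
    \<open>g \<gamma>\<close>: a call chooses what it pushes, while a return must match what was
    already pushed.\<close>
  have returns: "(e p, a, g \<gamma>, v, y) \<in> vpt_returns (rename_vpt e g A) \<longleftrightarrow>
      (\<exists>q. y = e q \<and> (p, a, \<gamma>, v, q) \<in> vpt_returns A)"
    if "p \<in> vpt_states A" "\<gamma> \<in> vpt_stack A" for p a \<gamma> v y
  proof
    assume "(e p, a, g \<gamma>, v, y) \<in> vpt_returns (rename_vpt e g A)"
    then obtain p' \<gamma>' q where ret: "(p', a, \<gamma>', v, q) \<in> vpt_returns A"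
      and eq: "e p = e p'" "g \<gamma> = g \<gamma>'" "y = e q"
      by (auto simp: rename_vpt_def)
    have "p = p'" "\<gamma> = \<gamma>'"
      using that eq is_vpt_returnD(1,3)[OF A ret] inj_onD[OF e] inj_onD[OF g] by blast+
    then show "\<exists>q. y = e q \<and> (p, a, \<gamma>, v, q) \<in> vpt_returns A"
      using ret eq(3) by blast
  qed (blast intro: rename_return)
  \<comment> \<open>Allowing all labels makes the induction rule applicable to an arbitrary
    hedge.\<close>
  have "h \<in> hedges UNIV"
    by (simp add: hedges_def lists_UNIV)
  then show ?thesis
    using assms(4)
  proof (induction h arbitrary: p v y rule: hedges_induct)
    case empty
    show ?case
    proof
      assume "neutral_run botc botr (rename_vpt e g A) (e p) [] v y"
      then obtain \<gamma> m v1 v2 where call: "(p, botc, \<gamma>, v1, m) \<in> vpt_calls A" and v: "v = v1 @ v2"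
        and ret: "(e m, botr, g \<gamma>, v2, y) \<in> vpt_returns (rename_vpt e g A)"
        by (auto simp: calls[OF empty])
      then show "\<exists>q. y = e q \<and> neutral_run botc botr A p [] v q"
        unfolding neutral_run.simps using returns is_vpt_callD[OF A call] call v by blast
    next
      assume "\<exists>q. y = e q \<and> neutral_run botc botr A p [] v q"
      then show "neutral_run botc botr (rename_vpt e g A) (e p) [] v y"
        unfolding neutral_run.simps by (blast intro: rename_call rename_return)
    qed
  next
    case (node f h h')
    obtain c r where f: "f = (c, r)" by (cases f)
    show ?case
    proof
      assume "neutral_run botc botr (rename_vpt e g A) (e p) (Node f h # h') v y"
      then obtain \<gamma> p' x x' v1 s1 s2 v2 where call: "(p, c, \<gamma>, v1, p') \<in> vpt_calls A"
        and run1: "neutral_run botc botr (rename_vpt e g A) (e p') h s1 x"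
        and run2: "neutral_run botc botr (rename_vpt e g A) x h' s2 x'"
        and ret: "(x', r, g \<gamma>, v2, y) \<in> vpt_returns (rename_vpt e g A)"
        and v: "v = v1 @ s1 @ s2 @ v2"
        by (auto simp: f calls[OF node.prems])
      obtain m where m: "x = e m" "neutral_run botc botr A p' h s1 m"
        using node.IH(1) run1 is_vpt_callD[OF A call] by blast
      obtain q' where q': "x' = e q'" "neutral_run botc botr A m h' s2 q'"
        using node.IH(2) run2 m(1) neutral_run_states(2)[OF A m(2)] by blast
      obtain q where "y = e q" "(q', r, \<gamma>, v2, q) \<in> vpt_returns A"
        using ret returns is_vpt_callD(3)[OF A call] neutral_run_states(2)[OF A q'(2)] q'(1) by blast
      then show "\<exists>q. y = e q \<and> neutral_run botc botr A p (Node f h # h') v q"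
        unfolding f neutral_run.simps using call m(2) q'(2) v by blast
    next
      assume "\<exists>q. y = e q \<and> neutral_run botc botr A p (Node f h # h') v q"
      then obtain q \<gamma> p' m q' v1 s1 s2 v2 where y: "y = e q"
        and call: "(p, c, \<gamma>, v1, p') \<in> vpt_calls A"
        and run: "neutral_run botc botr A p' h s1 m" "neutral_run botc botr A m h' s2 q'"
        and ret: "(q', r, \<gamma>, v2, q) \<in> vpt_returns A" and v: "v = v1 @ s1 @ s2 @ v2"
        by (auto simp: f)
      have "(e p, c, g \<gamma>, v1, e p') \<in> vpt_calls (rename_vpt e g A)"
        "(e q', r, g \<gamma>, v2, e q) \<in> vpt_returns (rename_vpt e g A)"
        using call ret by (blast intro: rename_call rename_return)+
      moreover have "neutral_run botc botr (rename_vpt e g A) (e p') h s1 (e m)"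
        "neutral_run botc botr (rename_vpt e g A) (e m) h' s2 (e q')"
        using node.IH(1)[OF neutral_run_states(1)[OF A run(1)]]
          node.IH(2)[OF neutral_run_states(1)[OF A run(2)]] run by auto
      ultimately show "neutral_run botc botr (rename_vpt e g A) (e p) (Node f h # h') v y"
        unfolding f y v neutral_run.simps by blast
    qed
  qed
qed

lemma neutral_run_rename_accepting:
  assumes A: "is_vpt Sc Sr D A" and e: "inj_on e (vpt_states A)" and g: "inj_on g (vpt_stack A)"
  shows "(\<exists>p \<in> vpt_initial (rename_vpt e g A). \<exists>q \<in> vpt_final (rename_vpt e g A).
      neutral_run botc botr (rename_vpt e g A) p h v q) \<longleftrightarrow>
    (\<exists>p \<in> vpt_initial A. \<exists>q \<in> vpt_final A. neutral_run botc botr A p h v q)"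
proof -
  have sub: "vpt_initial A \<subseteq> vpt_states A" "vpt_final A \<subseteq> vpt_states A"
    using A by (auto simp: is_vpt_def)
  have "neutral_run botc botr (rename_vpt e g A) (e p) h v (e q) \<longleftrightarrow>
      neutral_run botc botr A p h v q" if "p \<in> vpt_initial A" "q \<in> vpt_final A" for p q
    using that sub e neutral_run_rename[OF A e g, of p] neutral_run_states(2)[OF A]
    by (metis inj_onD subsetD)
  then show ?thesis
    by (simp add: rename_vpt_def)
qed

section \<open>From pushdown transducers to hedge transducers\<close>

(* A state (p, q, None) stands for nonempty hedges, and (p, q, Some u) for the empty hedge whose
   leaf outputs u. *)

definition leaf_output :: "'d list option \<Rightarrow> 'd list" where
  "leaf_output x = (case x of None \<Rightarrow> [] | Some u \<Rightarrow> u)"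

lemma leaf_output_simps [simp]: "leaf_output None = []" "leaf_output (Some u) = u"
  by (simp_all add: leaf_output_def)

definition transition_output :: "'q \<times> 'a \<times> 'g \<times> 'd list \<times> 'q \<Rightarrow> 'd list" where
  "transition_output = (\<lambda>(q, a, \<gamma>, v, q'). v)"

text \<open>A leaf outputs the concatenation of a call output and a return output; taking these for
  all pairs of transitions bounds the guesses by a finite set.\<close>

definition sim_states :: "('q, 'g, 'a, 'd) vpt \<Rightarrow> ('q \<times> 'q \<times> 'd list option) set" where
  "sim_states A = vpt_states A \<times> vpt_states A \<times>
    insert None (Some ` (\<lambda>(t, t'). transition_output t @ transition_output t') `
      (vpt_calls A \<times> vpt_returns A))"

text \<open>The left-hand state carries \<open>None\<close> because a hedge with a first tree is
  nonempty. The guesses \<open>x\<close>, \<open>x'\<close> for the two subhedges are paid for here,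
  in $w_1$ and $w_2$; the shared \<open>m\<close> glues the two subruns, and the shared \<gamma>
  matches the call with its return.\<close>

definition sim_rules :: "'a set \<Rightarrow> 'a set \<Rightarrow> ('q, 'g, 'a, 'd) vpt \<Rightarrow>
    (('q \<times> 'q \<times> 'd list option) \<times> ('a \<times> 'a) \<times> 'd list \<times> ('q \<times> 'q \<times> 'd list option) \<times>
      'd list \<times> ('q \<times> 'q \<times> 'd list option) \<times> 'd list) set" where
  "sim_rules Sc Sr A = {((p, q, None), (c, r), v1 @ leaf_output x, (p', m, x),
      leaf_output x', (m, q', x'), v2) | p q c r \<gamma> v1 p' m x q' x' v2.
    c \<in> Sc \<and> r \<in> Sr \<and> (p, c, \<gamma>, v1, p') \<in> vpt_calls A \<and> (q', r, \<gamma>, v2, q) \<in> vpt_returns A \<and>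
    (p', m, x) \<in> sim_states A \<and> (m, q', x') \<in> sim_states A}"

text \<open>A guess \<open>Some u\<close> is verified at the empty rule against an actual leaf run
  with output \<open>u\<close>. Initial states carry \<open>None\<close>, which has no empty rule,
  so the empty hedge is rejected.\<close>

definition sim_hst :: "'a set \<Rightarrow> 'a set \<Rightarrow> 'a \<Rightarrow> 'a \<Rightarrow> ('q, 'g, 'a, 'd) vpt \<Rightarrow>
    ('q \<times> 'q \<times> 'd list option, 'a \<times> 'a, 'd) hst" where
  "sim_hst Sc Sr botc botr A = \<lparr>hst_states = sim_states A,
    hst_initial = vpt_initial A \<times> vpt_final A \<times> {None},
    hst_empty_rules = {(p, q, Some u) | p q u.
      (p, q, Some u) \<in> sim_states A \<and> neutral_run botc botr A p [] u q},
    hst_rules = sim_rules Sc Sr A\<rparr>"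

lemma finite_sim_rules:
  assumes A: "is_vpt Sc' Sr' D A"
  shows "finite (sim_rules Sc Sr A)"
proof (rule finite_surj)
  show "finite (vpt_calls A \<times> vpt_returns A \<times> sim_states A \<times> sim_states A)"
    using A by (simp add: is_vpt_def sim_states_def)
  \<comment> \<open>A rule is determined by a call, a return and two child states. The image also
    contains mismatched combinations, such as \<gamma> differing from \<open>\<gamma>'\<close>;
    inclusion suffices for finiteness.\<close>
  show "sim_rules Sc Sr A \<subseteq>
      (\<lambda>((p, c, \<gamma>, v1, p'), (q', r, \<gamma>', v2, q), (y, m, x), (m', z, x')).
        ((p, q, None), (c, r), v1 @ leaf_output x, (p', m, x), leaf_output x', (m, q', x'), v2)) `
      (vpt_calls A \<times> vpt_returns A \<times> sim_states A \<times> sim_states A)"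
    unfolding sim_rules_def by (force simp: image_iff)
qed

lemma sim_states_output:
  assumes A: "is_vpt Sc' Sr' D A" and "(p, q, x) \<in> sim_states A"
  shows "leaf_output x \<in> lists D"
  using assms(2)
  by (auto simp: sim_states_def transition_output_def dest!: is_vpt_callD(4)[OF A]
      is_vpt_returnD(4)[OF A])

lemma sim_states_None: "(p, q, None) \<in> sim_states A \<longleftrightarrow> p \<in> vpt_states A \<and> q \<in> vpt_states A"
  by (simp add: sim_states_def)

lemma is_hst_sim:
  assumes A: "is_vpt Sc' Sr' D A"
  shows "is_hst (Sc \<times> Sr) D (sim_hst Sc Sr botc botr A)"
proof -
  have "sim_rules Sc Sr A \<subseteq> sim_states A \<times> (Sc \<times> Sr) \<times> lists D \<times> sim_states A \<times> lists D \<times>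
      sim_states A \<times> lists D"
  proof
    fix \<rho>
    assume "\<rho> \<in> sim_rules Sc Sr A"
    then obtain p q c r \<gamma> v1 p' m x q' x' v2 where
      \<rho>: "\<rho> = ((p, q, None), (c, r), v1 @ leaf_output x, (p', m, x), leaf_output x', (m, q', x'), v2)"
      and "c \<in> Sc" "r \<in> Sr" and call: "(p, c, \<gamma>, v1, p') \<in> vpt_calls A"
      and ret: "(q', r, \<gamma>, v2, q) \<in> vpt_returns A"
      and st: "(p', m, x) \<in> sim_states A" "(m, q', x') \<in> sim_states A"
      unfolding sim_rules_def by blast
    then show "\<rho> \<in> sim_states A \<times> (Sc \<times> Sr) \<times> lists D \<times> sim_states A \<times> lists D \<times>
      sim_states A \<times> lists D"
      using is_vpt_callD[OF A call] is_vpt_returnD[OF A ret] st[THEN sim_states_output[OF A]]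
      by (simp add: sim_states_None)
  qed
  moreover have "finite (sim_states A)" "vpt_initial A \<times> vpt_final A \<times> {None} \<subseteq> sim_states A"
    using A by (auto simp: is_vpt_def sim_states_def)
  ultimately show ?thesis
    using finite_sim_rules[OF A] by (auto simp: is_hst_def sim_hst_def)
qed

text \<open>Invariant: the run's output is what the parent writes on behalf of a leaf, followed by
  what the transducer writes itself. On the empty hedge the second factor is empty, on nonempty
  hedges the first.\<close>

lemma neutral_run_sim:
  assumes A: "is_vpt Sc' Sr' D A" and "h \<in> hedges (Sc \<times> Sr)"
    and "p \<in> vpt_states A" "q \<in> vpt_states A"
  shows "neutral_run botc botr A p h v q \<longleftrightarrow> (\<exists>x s. (p, q, x) \<in> sim_states A \<and>
    s \<in> hst_sem (sim_hst Sc Sr botc botr A) (p, q, x) h \<and> v = leaf_output x @ s)"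
  using assms(2-)
proof (induction h arbitrary: p q v rule: hedges_induct)
  case empty
  \<comment> \<open>Guessing the whole leaf output \<open>v\<close> is possible because it arises
    from one call and one return transition.\<close>
  have "(p, q, Some v) \<in> sim_states A" if run: "neutral_run botc botr A p [] v q"
  proof -
    obtain \<gamma> m v1 v2 where "(p, botc, \<gamma>, v1, m) \<in> vpt_calls A"
      "(m, botr, \<gamma>, v2, q) \<in> vpt_returns A" "v = v1 @ v2"
      using run by auto
    then have "Some v \<in> Some ` (\<lambda>(t, t'). transition_output t @ transition_output t') `
      (vpt_calls A \<times> vpt_returns A)"
      by (force simp: transition_output_def image_iff)
    then show ?thesis using empty by (simp add: sim_states_def)
  qed
  then show ?case
    by (auto simp: sim_hst_def simp del: neutral_run.simps)
next
  case (node f h h')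
  obtain c r where f: "f = (c, r)" by (cases f)
  let ?T = "sim_hst Sc Sr botc botr A"
  show ?case
  proof
    assume "neutral_run botc botr A p (Node f h # h') v q"
    then obtain \<gamma> p' m q' v1 s1 s2 v2 where call: "(p, c, \<gamma>, v1, p') \<in> vpt_calls A"
      and run1: "neutral_run botc botr A p' h s1 m"
      and run2: "neutral_run botc botr A m h' s2 q'"
      and ret: "(q', r, \<gamma>, v2, q) \<in> vpt_returns A" and v: "v = v1 @ s1 @ s2 @ v2"
      by (auto simp: f)
    note states = neutral_run_states[OF A run1] neutral_run_states[OF A run2]
    obtain x t where x: "(p', m, x) \<in> sim_states A" "t \<in> hst_sem ?T (p', m, x) h"
      "s1 = leaf_output x @ t"
      using node.IH(1) run1 states by blast
    obtain x' t' where x': "(m, q', x') \<in> sim_states A" "t' \<in> hst_sem ?T (m, q', x') h'"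
      "s2 = leaf_output x' @ t'"
      using node.IH(2) run2 states by blast
    have "((p, q, None), f, v1 @ leaf_output x, (p', m, x), leaf_output x', (m, q', x'), v2)
        \<in> hst_rules ?T"
      using call ret x(1) x'(1) node.hyps(1) by (auto simp: f sim_hst_def sim_rules_def)
    moreover have "v = (v1 @ leaf_output x) @ t @ leaf_output x' @ t' @ v2"
      by (simp add: v x(3) x'(3))
    ultimately have "v \<in> hst_sem ?T (p, q, None) (Node f h # h')"
      using x(2) x'(2) unfolding hst_sem.simps by blast
    then show "\<exists>x s. (p, q, x) \<in> sim_states A \<and> s \<in> hst_sem ?T (p, q, x) (Node f h # h') \<and>
        v = leaf_output x @ s"
      using node.prems by (intro exI[of _ None] exI[of _ v]) (simp add: sim_states_None)
  next
    assume "\<exists>x s. (p, q, x) \<in> sim_states A \<and> s \<in> hst_sem ?T (p, q, x) (Node f h # h') \<and>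
        v = leaf_output x @ s"
    then obtain y w1 q1 s1 w2 q2 s2 w3 where v: "v = leaf_output y @ w1 @ s1 @ w2 @ s2 @ w3"
      and rule: "((p, q, y), (c, r), w1, q1, w2, q2, w3) \<in> sim_rules Sc Sr A"
      and s: "s1 \<in> hst_sem ?T q1 h" "s2 \<in> hst_sem ?T q2 h'"
      by (auto simp: f sim_hst_def)
    from rule obtain \<gamma> v1 p' m x q' x' where y: "y = None"
      and w: "w1 = v1 @ leaf_output x" "w2 = leaf_output x'" "q1 = (p', m, x)" "q2 = (m, q', x')"
      and call: "(p, c, \<gamma>, v1, p') \<in> vpt_calls A" and ret: "(q', r, \<gamma>, w3, q) \<in> vpt_returns A"
      and st: "(p', m, x) \<in> sim_states A" "(m, q', x') \<in> sim_states A"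
      unfolding sim_rules_def by blast
    \<comment> \<open>These memberships are what the induction hypotheses require; each guessed leaf
      output then moves from the rule back into its subrun.\<close>
    have "p' \<in> vpt_states A" "m \<in> vpt_states A" "q' \<in> vpt_states A"
      using st by (auto simp: sim_states_def)
    then have "neutral_run botc botr A p' h (leaf_output x @ s1) m"
      "neutral_run botc botr A m h' (leaf_output x' @ s2) q'"
      using node.IH s st w by blast+
    then show "neutral_run botc botr A p (Node f h # h') v q"
      using call ret by (fastforce simp: f v y w)
  qed
qed

lemma sim_hst_nonempty:
  "h \<noteq> [] \<Longrightarrow> s \<in> hst_sem (sim_hst Sc Sr botc botr A) (p, q, x) h \<Longrightarrow> x = None"
  by (cases "(sim_hst Sc Sr botc botr A, (p, q, x), h)" rule: hst_sem.cases)
    (auto simp: sim_hst_def sim_rules_def)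

lemma Nil_not_in_sim_hst: "([], s) \<notin> hst_rel (sim_hst Sc Sr botc botr A)"
  by (auto simp: hst_rel_def sim_hst_def)

text \<open>A nonempty hedge forces the guess \<open>None\<close>, the one carried by the initial
  states, so no leaf output is lost at the root.\<close>

lemma hst_rel_sim_iff:
  assumes A: "is_vpt Sc' Sr' D A" and h: "h \<in> hedges (Sc \<times> Sr)" "h \<noteq> []"
  shows "(h, v) \<in> hst_rel (sim_hst Sc Sr botc botr A) \<longleftrightarrow>
    (\<exists>p \<in> vpt_initial A. \<exists>q \<in> vpt_final A. neutral_run botc botr A p h v q)"
proof -
  have "neutral_run botc botr A p h v q \<longleftrightarrow> v \<in> hst_sem (sim_hst Sc Sr botc botr A) (p, q, None) h"
    if "p \<in> vpt_initial A" "q \<in> vpt_final A" for p q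
  proof -
    have pq: "p \<in> vpt_states A" "q \<in> vpt_states A"
      using that A by (auto simp: is_vpt_def)
    show ?thesis
      unfolding neutral_run_sim[OF A h(1) pq]
      using sim_hst_nonempty[OF h(2)] pq
      by (metis append_Nil leaf_output_simps(1) sim_states_None)
  qed
  moreover have "hst_initial (sim_hst Sc Sr botc botr A) = vpt_initial A \<times> vpt_final A \<times> {None}"
    by (simp add: sim_hst_def)
  ultimately show ?thesis
    by (auto simp: hst_rel_def)
qed

section \<open>From hedge transducers to pushdown transducers\<close>

datatype ('q, 'r) control = Root 'q | First 'r | Second 'r | Close 'r | Leaf | Accept

(* (s, q, u, t): in control state s, the next hedge is evaluated in state q after writing the
   pending output u, and the control state afterwards is t. *)
definition tasks :: "('q, 'f, 'd) hst \<Rightarrow>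
    (('q, 'q \<times> 'f \<times> 'd list \<times> 'q \<times> 'd list \<times> 'q \<times> 'd list) control \<times> 'q \<times> 'd list \<times>
      ('q, 'q \<times> 'f \<times> 'd list \<times> 'q \<times> 'd list \<times> 'q \<times> 'd list) control) set" where
  "tasks T = (\<lambda>q. (Root q, q, [], Accept)) ` hst_initial T \<union>
    (\<lambda>\<rho>. case \<rho> of (q, f, w1, q1, w2, q2, w3) \<Rightarrow> (First \<rho>, q1, [], Second \<rho>)) ` hst_rules T \<union>
    (\<lambda>\<rho>. case \<rho> of (q, f, w1, q1, w2, q2, w3) \<Rightarrow> (Second \<rho>, q2, w2, Close \<rho>)) ` hst_rules T"

text \<open>Tasks are a partial function of the control state, since the constructor and the rule
  inside it fix everything. Hence the popped state alone tells a return where to continue.\<close>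

lemma tasks_iff:
  "(s, q, u, t) \<in> tasks T \<Longrightarrow> (s, q', u', t') \<in> tasks T \<longleftrightarrow> q' = q \<and> u' = u \<and> t' = t"
  by (rule iffI, (auto simp: tasks_def)[1], simp)

lemma task_First: "\<rho> = (q, f, w1, q1, w2, q2, w3) \<Longrightarrow> \<rho> \<in> hst_rules T \<Longrightarrow>
    (First \<rho>, q1, [], Second \<rho>) \<in> tasks T"
  and task_Second: "\<rho> = (q, f, w1, q1, w2, q2, w3) \<Longrightarrow> \<rho> \<in> hst_rules T \<Longrightarrow>
    (Second \<rho>, q2, w2, Close \<rho>) \<in> tasks T"
  and task_Root: "q \<in> hst_initial T \<Longrightarrow> (Root q, q, [], Accept) \<in> tasks T"
  by (force simp: tasks_def)+

definition control_states :: "('q, 'f, 'd) hst \<Rightarrow>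
    ('q, 'q \<times> 'f \<times> 'd list \<times> 'q \<times> 'd list \<times> 'q \<times> 'd list) control set" where
  "control_states T = {Leaf, Accept} \<union> Root ` hst_initial T \<union>
    First ` hst_rules T \<union> Second ` hst_rules T \<union> Close ` hst_rules T"

lemma tasks_states:
  assumes "is_hst L D T" "(s, q, u, t) \<in> tasks T"
  shows "s \<in> control_states T - {Accept}" "t \<in> control_states T" "u \<in> lists D"
  using assms(2)
  by (auto simp: tasks_def control_states_def dest: is_hst_ruleD(5)[OF assms(1)])

definition control_calls where
  "control_calls botc T =
    {(s, c, s, u @ w1, First (q, (c, r), w1, q1, w2, q2, w3)) | s q u t c r w1 q1 w2 q2 w3.
      (s, q, u, t) \<in> tasks T \<and> (q, (c, r), w1, q1, w2, q2, w3) \<in> hst_rules T} \<union>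
    {(s, botc, s, u, Leaf) | s q u t. (s, q, u, t) \<in> tasks T \<and> q \<in> hst_empty_rules T}"

text \<open>The return letter guessed at the call is enforced by the rule remembered in
  \<open>Close\<close>; the target \<open>t\<close> is looked up from the popped
  \<open>s\<close>.\<close>

definition control_returns where
  "control_returns botr T =
    {(Close (q', (c, r), w1, q1, w2, q2, w3), r, s, w3, t) | s q u t q' c r w1 q1 w2 q2 w3.
      (s, q, u, t) \<in> tasks T \<and> (q', (c, r), w1, q1, w2, q2, w3) \<in> hst_rules T} \<union>
    {(Leaf, botr, s, [], t) | s q u t. (s, q, u, t) \<in> tasks T}"

(* Accept is never pushed, so it can double as the bottom symbol. *)
definition control_vpt where
  "control_vpt botc botr T = \<lparr>vpt_states = control_states T, vpt_initial = Root ` hst_initial T,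
    vpt_final = {Accept}, vpt_stack = control_states T - {Accept}, vpt_bottom = Accept,
    vpt_calls = control_calls botc T, vpt_returns = control_returns botr T\<rparr>"

lemma is_vpt_control:
  assumes T: "is_hst (Sc \<times> Sr) D T"
  shows "is_vpt (insert botc Sc) (insert botr Sr) D (control_vpt botc botr T)"
proof -
  have fin: "finite (hst_initial T)" "finite (hst_rules T)"
    using T by (auto simp: is_hst_def intro: finite_subset)
  then have fin': "finite (control_states T)" "finite (tasks T)"
    by (auto simp: control_states_def tasks_def)
  have task: "s \<in> control_states T \<and> s \<noteq> Accept \<and> t \<in> control_states T \<and> u \<in> lists D"
    if "(s, q, u, t) \<in> tasks T" for s q u t
    using tasks_states[OF T that] by simp
  have rule: "c \<in> Sc" "r \<in> Sr" "set w1 \<subseteq> D" "set w3 \<subseteq> D"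
    if "(q, (c, r), w1, q1, w2, q2, w3) \<in> hst_rules T" for q c r w1 q1 w2 q2 w3
    using is_hst_ruleD[OF T that] by auto
  have leaf: "Leaf \<in> control_states T"
    by (simp add: control_states_def)
  have states: "First \<rho> \<in> control_states T" "Close \<rho> \<in> control_states T"
    if "\<rho> \<in> hst_rules T" for \<rho>
    using that by (auto simp: control_states_def)
  have "finite (control_calls botc T)"
  proof (rule finite_subset)
    show "control_calls botc T \<subseteq>
      (\<lambda>((s, q, u, t), \<rho>). case \<rho> of (q', (c, r), w1, q1, w2, q2, w3) \<Rightarrow> (s, c, s, u @ w1, First \<rho>)) `
        (tasks T \<times> hst_rules T) \<union>
      (\<lambda>(s, q, u, t). (s, botc, s, u, Leaf)) ` tasks T"
      unfolding control_calls_def by (force simp: image_iff)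
  qed (use fin fin' in simp)
  moreover have "finite (control_returns botr T)"
  proof (rule finite_subset)
    show "control_returns botr T \<subseteq>
      (\<lambda>((s, q, u, t), \<rho>). case \<rho> of (q', (c, r), w1, q1, w2, q2, w3) \<Rightarrow> (Close \<rho>, r, s, w3, t)) `
        (tasks T \<times> hst_rules T) \<union>
      (\<lambda>(s, q, u, t). (Leaf, botr, s, [], t)) ` tasks T"
      unfolding control_returns_def by (force simp: image_iff)
  qed (use fin fin' in simp)
  moreover have "control_calls botc T \<subseteq> control_states T \<times> insert botc Sc \<times>
      (control_states T - {Accept}) \<times> lists D \<times> control_states T"
    by (auto simp: control_calls_def leaf states dest!: task dest: rule(1,2) rule(3,4)[THEN subsetD])
  moreover have "control_returns botr T \<subseteq> control_states T \<times> insert botr Sr \<times>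
      (control_states T - {Accept}) \<times> lists D \<times> control_states T"
    by (auto simp: control_returns_def leaf states dest!: task dest: rule(1,2) rule(3,4)[THEN subsetD])
  moreover have "Root ` hst_initial T \<subseteq> control_states T" "{Accept} \<subseteq> control_states T"
    by (auto simp: control_states_def)
  ultimately show ?thesis
    using fin' by (simp add: is_vpt_def control_vpt_def)
qed

lemma control_call_iff:
  assumes "(s, q, u, t) \<in> tasks T"
  shows "(s, a, \<gamma>, v, m) \<in> vpt_calls (control_vpt botc botr T) \<longleftrightarrow> \<gamma> = s \<and>
    ((\<exists>r w1 q1 w2 q2 w3. (q, (a, r), w1, q1, w2, q2, w3) \<in> hst_rules T \<and> v = u @ w1 \<and>
        m = First (q, (a, r), w1, q1, w2, q2, w3)) \<or>
      a = botc \<and> v = u \<and> m = Leaf \<and> q \<in> hst_empty_rules T)"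
  by (auto simp: control_vpt_def control_calls_def tasks_iff[OF assms])

lemma control_return_Close_iff:
  assumes "(s, q, u, t) \<in> tasks T" "(q', (c, r), w1, q1, w2, q2, w3) \<in> hst_rules T"
  shows "(Close (q', (c, r), w1, q1, w2, q2, w3), b, s, v, m) \<in> vpt_returns (control_vpt botc botr T)
    \<longleftrightarrow> b = r \<and> v = w3 \<and> m = t"
  using assms(2) by (auto simp: control_vpt_def control_returns_def tasks_iff[OF assms(1)])

lemma control_return_Leaf_iff:
  assumes "(s, q, u, t) \<in> tasks T"
  shows "(Leaf, b, s, v, m) \<in> vpt_returns (control_vpt botc botr T) \<longleftrightarrow> b = botr \<and> v = [] \<and> m = t"
  by (auto simp: control_vpt_def control_returns_def tasks_iff[OF assms])

lemma neutral_run_control: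
  assumes T: "is_hst (Sc \<times> Sr) D T" and bot: "botc \<notin> Sc"
    and "h \<in> hedges (Sc \<times> Sr)" "(s, q, u, t) \<in> tasks T"
  shows "neutral_run botc botr (control_vpt botc botr T) s h v m \<longleftrightarrow>
    m = t \<and> (\<exists>o'. v = u @ o' \<and> o' \<in> hst_sem T q h)"
  using assms(3,4)
proof (induction h arbitrary: s q u t v m rule: hedges_induct)
  case empty
  \<comment> \<open>Freshness of \<open>botc\<close>: at a leaf no transition coming from a rule can
    fire. Dually, \<open>c \<noteq> botc\<close> in the node case rules out the leaf
    transition.\<close>
  have "(q, (botc, r), w1, q1, w2, q2, w3) \<notin> hst_rules T" for r w1 q1 w2 q2 w3
    using is_hst_ruleD(2)[OF T] bot by blast
  then show ?case
    by (auto simp: control_call_iff[OF empty] control_return_Leaf_iff[OF empty])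
next
  case (node f h h')
  obtain c r where f: "f = (c, r)" by (cases f)
  then have "c \<noteq> botc"
    using node.hyps(1) bot by auto
  let ?A = "control_vpt botc botr T"
  note call = control_call_iff[OF node.prems]
  show ?case
  proof
    assume "neutral_run botc botr ?A s (Node f h # h') v m"
    then obtain \<gamma> p' n q' v1 s1 s2 v2 where "(s, c, \<gamma>, v1, p') \<in> vpt_calls ?A"
      and run1: "neutral_run botc botr ?A p' h s1 n"
      and run2: "neutral_run botc botr ?A n h' s2 q'"
      and ret: "(q', r, \<gamma>, v2, m) \<in> vpt_returns ?A" and v: "v = v1 @ s1 @ s2 @ v2"
      by (auto simp: f)
    then obtain r' w1 q1 w2 q2 w3 \<rho> where \<rho>: "\<rho> = (q, (c, r'), w1, q1, w2, q2, w3)"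
      and rule: "\<rho> \<in> hst_rules T" and eq: "v1 = u @ w1" "p' = First \<rho>" "\<gamma> = s"
      using \<open>c \<noteq> botc\<close> by (auto simp: call)
    \<comment> \<open>The induction hypothesis also fixes the state reached, so the first subrun
      ends in \<open>Second \<rho>\<close> and the second one in
      \<open>Close \<rho>\<close>.\<close>
    have s1: "n = Second \<rho>" "s1 \<in> hst_sem T q1 h"
      using run1 node.IH(1)[OF task_First[OF \<rho> rule]] by (auto simp: eq)
    obtain o2 where s2: "q' = Close \<rho>" "s2 = w2 @ o2" "o2 \<in> hst_sem T q2 h'"
      using run2 node.IH(2)[OF task_Second[OF \<rho> rule]] by (auto simp: s1)
    \<comment> \<open>Here the guessed letter \<open>r'\<close> meets the letter actually read, and
      popping \<open>s\<close> leads to \<open>t\<close>.\<close>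
    have "r = r'" "v2 = w3" "m = t"
      using ret control_return_Close_iff[OF node.prems rule[unfolded \<rho>]] by (auto simp: s2 eq \<rho>)
    then show "m = t \<and> (\<exists>o'. v = u @ o' \<and> o' \<in> hst_sem T q (Node f h # h'))"
      using rule s1(2) s2(3) by (auto simp: v eq s2(2) \<rho> f) blast
  next
    assume "m = t \<and> (\<exists>o'. v = u @ o' \<and> o' \<in> hst_sem T q (Node f h # h'))"
    then obtain w1 q1 s1 w2 q2 s2 w3 \<rho> where m: "m = t" and v: "v = u @ w1 @ s1 @ w2 @ s2 @ w3"
      and \<rho>: "\<rho> = (q, (c, r), w1, q1, w2, q2, w3)" and rule: "\<rho> \<in> hst_rules T"
      and s: "s1 \<in> hst_sem T q1 h" "s2 \<in> hst_sem T q2 h'"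
      by (auto simp: f)
    have "(s, c, s, u @ w1, First \<rho>) \<in> vpt_calls ?A"
      using rule by (auto simp: call \<rho>)
    moreover have "neutral_run botc botr ?A (First \<rho>) h s1 (Second \<rho>)"
      using node.IH(1)[OF task_First[OF \<rho> rule]] s by simp
    moreover have "neutral_run botc botr ?A (Second \<rho>) h' (w2 @ s2) (Close \<rho>)"
      using node.IH(2)[OF task_Second[OF \<rho> rule]] s by simp
    moreover have "(Close \<rho>, r, s, w3, t) \<in> vpt_returns ?A"
      using control_return_Close_iff[OF node.prems rule[unfolded \<rho>]] by (simp add: \<rho>)
    \<comment> \<open>The delayed \<open>w2\<close> counts as output of the second subrun, just as
      \<open>u\<close> is written by the call of the whole hedge.\<close>
    moreover have "v = (u @ w1) @ s1 @ (w2 @ s2) @ w3"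
      by (simp add: v)
    ultimately show "neutral_run botc botr ?A s (Node f h # h') v m"
      unfolding f m neutral_run.simps by blast
  qed
qed

lemma hst_rel_control_iff:
  fixes botc botr
  assumes T: "is_hst (Sc \<times> Sr) D T" and bot: "botc \<notin> Sc" and h: "h \<in> hedges (Sc \<times> Sr)"
  defines "A \<equiv> control_vpt botc botr T"
  shows "(\<exists>p \<in> vpt_initial A. \<exists>q \<in> vpt_final A. neutral_run botc botr A p h v q) \<longleftrightarrow>
    (h, v) \<in> hst_rel T"
proof -
  have "vpt_initial A = Root ` hst_initial T" "vpt_final A = {Accept}"
    by (simp_all add: A_def control_vpt_def)
  moreover have "neutral_run botc botr A (Root q) h v Accept \<longleftrightarrow> v \<in> hst_sem T q h"
    if "q \<in> hst_initial T" for q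
    using neutral_run_control[OF T bot h task_Root[OF that]] by (simp add: A_def)
  ultimately show ?thesis
    by (auto simp: hst_rel_def)
qed

section \<open>Equivalence of the two transducer models\<close>

theorem lemma5:
  fixes Sc Sr :: "'a set" and botc botr :: 'a and D :: "'d set"
  assumes "structured_alphabet Sc Sr"
    and "botc \<notin> Sc \<union> Sr" and "botr \<notin> Sc \<union> Sr" and "botc \<noteq> botr"
    and "finite D"
  shows
    "(\<forall>A :: ('q, 'g, 'a, 'd) vpt.
        is_vpt (insert botc Sc) (insert botr Sr) D A \<and>
        fcns Sc Sr botc botr [] \<notin> Domain (vpt_rel A) \<longrightarrow>
        (\<exists>T :: (nat, 'a \<times> 'a, 'd) hst.
          is_hst (Sc \<times> Sr) D T \<and> [] \<notin> Domain (hst_rel T) \<and>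
          precompose (well_nested Sc Sr) (fcns Sc Sr botc botr) (vpt_rel A) =
          precompose (well_nested Sc Sr) (hedge Sc Sr) (hst_rel T))) \<and>
     (\<forall>T :: ('p, 'a \<times> 'a, 'd) hst.
        is_hst (Sc \<times> Sr) D T \<and> [] \<notin> Domain (hst_rel T) \<longrightarrow>
        (\<exists>A :: (nat, nat, 'a, 'd) vpt.
          is_vpt (insert botc Sc) (insert botr Sr) D A \<and>
          fcns Sc Sr botc botr [] \<notin> Domain (vpt_rel A) \<and>
          precompose (well_nested Sc Sr) (fcns Sc Sr botc botr) (vpt_rel A) =
          precompose (well_nested Sc Sr) (hedge Sc Sr) (hst_rel T)))"
proof (intro conjI allI impI)
  have disj: "Sc \<inter> Sr = {}" and disj': "insert botc Sc \<inter> insert botr Sr = {}"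
    using assms(1-4) by (auto simp: structured_alphabet_def)
  note in_hedges = hedge_in_hedges[OF disj]
  {
    fix A :: "('q, 'g, 'a, 'd) vpt"
    assume "is_vpt (insert botc Sc) (insert botr Sr) D A \<and>
      fcns Sc Sr botc botr [] \<notin> Domain (vpt_rel A)"
    then have A: "is_vpt (insert botc Sc) (insert botr Sr) D A"
      and empty: "(fcns Sc Sr botc botr [], v) \<notin> vpt_rel A" for v
      by auto
    let ?T = "sim_hst Sc Sr botc botr A"
    have T: "is_hst (Sc \<times> Sr) D ?T"
      by (rule is_hst_sim[OF A])
    then obtain e :: "'q \<times> 'q \<times> 'd list option \<Rightarrow> nat" where e: "inj_on e (hst_states ?T)"
      using ex_inj_on_nat by (metis is_hst_def)
    have "(fcns Sc Sr botc botr w, v) \<in> vpt_rel A \<longleftrightarrow> (hedge Sc Sr w, v) \<in> hst_rel ?T"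
      if w: "w \<in> well_nested Sc Sr" for w v
    proof (cases "w = []")
      \<comment> \<open>Neither side relates the empty word to anything: the pushdown transducer by
        assumption, the simulation because its initial states carry \<open>None\<close>.\<close>
      case True
      then show ?thesis
        using empty by (simp add: hedge_Nil[OF disj] Nil_not_in_sim_hst)
    next
      case False
      then have "hedge Sc Sr w \<noteq> []"
        using w by (metis list.distinct(1) hedge_decomp[OF disj] well_nested_decomp_exists)
      then show ?thesis
        by (simp add: vpt_rel_fcns_iff[OF A disj disj' w] hst_rel_sim_iff[OF A in_hedges[OF w]])
    qed
    then have "precompose (well_nested Sc Sr) (fcns Sc Sr botc botr) (vpt_rel A) =
        precompose (well_nested Sc Sr) (hedge Sc Sr) (hst_rel ?T)"
      by (auto simp: precompose_def)
    then show "\<exists>T :: (nat, 'a \<times> 'a, 'd) hst.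
        is_hst (Sc \<times> Sr) D T \<and> [] \<notin> Domain (hst_rel T) \<and>
        precompose (well_nested Sc Sr) (fcns Sc Sr botc botr) (vpt_rel A) =
        precompose (well_nested Sc Sr) (hedge Sc Sr) (hst_rel T)"
      using is_hst_rename[OF T, of e] hst_rel_rename[OF T e]
      by (intro exI[of _ "rename_hst e ?T"]) (auto simp: Nil_not_in_sim_hst)
  }
  {
    fix T :: "('p, 'a \<times> 'a, 'd) hst"
    assume "is_hst (Sc \<times> Sr) D T \<and> [] \<notin> Domain (hst_rel T)"
    then have T: "is_hst (Sc \<times> Sr) D T" and empty: "([], v) \<notin> hst_rel T" for v
      by auto
    let ?A = "control_vpt botc botr T"
    have A: "is_vpt (insert botc Sc) (insert botr Sr) D ?A"
      by (rule is_vpt_control[OF T])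
    then have "finite (vpt_states ?A)"
      by (simp add: is_vpt_def)
    then obtain e :: "_ \<Rightarrow> nat" where e: "inj_on e (vpt_states ?A)"
      using ex_inj_on_nat by blast
    \<comment> \<open>Stack symbols and bottom are themselves control states, so the single
      injection \<open>e\<close> renames states and stack alike.\<close>
    have "insert (vpt_bottom ?A) (vpt_stack ?A) \<subseteq> vpt_states ?A"
      by (auto simp: control_vpt_def control_states_def)
    then have e': "inj_on e (insert (vpt_bottom ?A) (vpt_stack ?A))"
      using e inj_on_subset by blast
    then have e'': "inj_on e (vpt_stack ?A)"
      by simp
    let ?B = "rename_vpt e e ?A"
    have B: "is_vpt (insert botc Sc) (insert botr Sr) D ?B"
      by (rule is_vpt_rename[OF A e'])
    have bot: "botc \<notin> Sc"
      using assms(2) by simp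
    have rel: "(fcns Sc Sr botc botr w, v) \<in> vpt_rel ?B \<longleftrightarrow> (hedge Sc Sr w, v) \<in> hst_rel T"
      if w: "w \<in> well_nested Sc Sr" for w v
      unfolding vpt_rel_fcns_iff[OF B disj disj' w] neutral_run_rename_accepting[OF A e e'']
      by (rule hst_rel_control_iff[OF T bot in_hedges[OF w]])
    \<comment> \<open>This is \<open>rel\<close> at the empty word, whose hedge is not accepted by
      \<open>T\<close>.\<close>
    then have "fcns Sc Sr botc botr [] \<notin> Domain (vpt_rel ?B)"
      using empty by (simp add: Domain_iff well_nested.empty hedge_Nil[OF disj])
    then show "\<exists>A :: (nat, nat, 'a, 'd) vpt.
        is_vpt (insert botc Sc) (insert botr Sr) D A \<and>
        fcns Sc Sr botc botr [] \<notin> Domain (vpt_rel A) \<and>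
        precompose (well_nested Sc Sr) (fcns Sc Sr botc botr) (vpt_rel A) =
        precompose (well_nested Sc Sr) (hedge Sc Sr) (hst_rel T)"
      using B rel by (intro exI[of _ ?B]) (auto simp: precompose_def)
  }
qed

end
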